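(* Let $v$ and $w$ be weights, and assume that for some constants $R>0$, $C>0$ and $0<\delta\le1$ the following hold for $w$ on the interval $]R,\infty[$: (i) $w$ is of class $C^2$; (ii) the function $r\mapsto|w'(r)|\,r^{1+\delta}$ is non-increasing; (iii) $-\frac{w(r)w''(r)}{w'(r)^2}\le C$. The following conditions are equivalent for an entire function $g\in H(\mathbb{C})$: (1) $V_g:H^\infty_v(\mathbb{C})\to H^\infty_w(\mathbb{C})$ is continuous. (2) $V_g:H^0_v(\mathbb{C})\to H^0_w(\mathbb{C})$ is continuous. (3) $\sup_{|z|>R}\frac{w(z)^2|g'(z)|}{|w'(z)|\,\tilde v(z)}<\infty$.
   Context: $H(\mathbb{C})$ is the space of entire functions. A weight is a continuous non-increasing function $v:[0,\infty[\to]0,\infty[$ with $\lim_{r\to\infty}r^mv(r)=0$ for each $m\in\mathbb{N}$; it is extended to $\mathbb{C}$ by $v(z):=v(|z|)$. For a weight $w$, $w'$ and $w''$ denote the derivatives with respect to $r\in[0,\infty[$, and $w'(z):=w'(|z|)$. For a weight $v$, $H^\infty_v(\mathbb{C})=\{f\in H(\mathbb{C}):\|f\|_v:=\sup_{z\in\mathbb{C}}v(|z|)|f(z)|<\infty\}$ and $H^0_v(\mathbb{C})=\{f\in H(\mathbb{C}):\lim_{|z|\to\infty}v(|z|)|f(z)|=0\}$, both endowed with the norm $\|\cdot\|_v$ (they are Banach spaces). The associated weight is $\tilde v(z):=\big(\sup\{|f(z)|:f\in H^\infty_v(\mathbb{C}),\ \|f\|_v\le1\}\big)^{-1}$, $z\in\mathbb{C}$.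 For $g\in H(\mathbb{C})$, $g'$ is the complex derivative and the Volterra operator is $V_g(f)(z):=\int_0^zf(\zeta)g'(\zeta)\,d\zeta$, $f\in H(\mathbb{C})$, $z\in\mathbb{C}$. Saying that an operator $T:X\to Y$ between two such spaces is continuous means that $T$ maps $X$ into $Y$ and is continuous for the given norms. *)

theory Defs
  imports "HOL-Complex_Analysis.Complex_Analysis"
begin

text \<open>
  A weight is a function on the interval \<open>[0,\<infinity>[\<close>; it is represented by a function on all reals
  whose values on negative arguments are irrelevant. The radial extension to the complex plane
  is written out as \<open>v (cmod z)\<close>.
\<close>

definition weight :: "(real \<Rightarrow> real) \<Rightarrow> bool" where
  "weight v \<longleftrightarrow>
     continuous_on {0..} v \<and>
     (\<forall>r\<ge>0. 0 < v r) \<and>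
     antimono_on {0..} v \<and>
     (\<forall>m::nat. ((\<lambda>r. r ^ m * v r) \<longlongrightarrow> 0) at_top)"

text \<open>
  The supremum is taken in the reals, so the value is meaningful only for \<open>f\<close> with
  \<open>v |f|\<close> bounded, i.e. on the space \<open>Hinf v\<close> below (which contains \<open>Hzero v\<close>).
\<close>

definition wnorm :: "(real \<Rightarrow> real) \<Rightarrow> (complex \<Rightarrow> complex) \<Rightarrow> real" where
  "wnorm v f = (SUP z. v (cmod z) * cmod (f z))"

definition Hinf :: "(real \<Rightarrow> real) \<Rightarrow> (complex \<Rightarrow> complex) set" where
  "Hinf v = {f. f holomorphic_on UNIV \<and> bdd_above (range (\<lambda>z. v (cmod z) * cmod (f z)))}"

definition Hzero :: "(real \<Rightarrow> real) \<Rightarrow> (complex \<Rightarrow> complex) set" where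
  "Hzero v = {f. f holomorphic_on UNIV \<and>
                 ((\<lambda>z. v (cmod z) * cmod (f z)) \<longlongrightarrow> 0) at_infinity}"

text \<open>
  For a weight \<open>v\<close> the supremum below is over a nonempty set bounded by \<open>1 / v (cmod z)\<close>, and
  it is positive because constants belong to \<open>Hinf v\<close>.
\<close>

definition assoc_weight :: "(real \<Rightarrow> real) \<Rightarrow> complex \<Rightarrow> real" where
  "assoc_weight v z = inverse (SUP f\<in>{f \<in> Hinf v. wnorm v f \<le> 1}. cmod (f z))"

definition Volterra :: "(complex \<Rightarrow> complex) \<Rightarrow> (complex \<Rightarrow> complex) \<Rightarrow> complex \<Rightarrow> complex" where
  "Volterra g f z = contour_integral (linepath 0 z) (\<lambda>\<zeta>. f \<zeta> * deriv g \<zeta>)"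

text \<open>
  \<open>T\<close> maps \<open>X\<close>, normed by \<open>wnorm v\<close>, into \<open>Y\<close>, normed by \<open>wnorm w\<close>, and is continuous
  at every point of \<open>X\<close>.
\<close>

definition continuous_operator ::
  "(real \<Rightarrow> real) \<Rightarrow> (complex \<Rightarrow> complex) set \<Rightarrow> (real \<Rightarrow> real) \<Rightarrow> (complex \<Rightarrow> complex) set \<Rightarrow>
   ((complex \<Rightarrow> complex) \<Rightarrow> complex \<Rightarrow> complex) \<Rightarrow> bool" where
  "continuous_operator v X w Y T \<longleftrightarrow>
     (\<forall>f\<in>X. T f \<in> Y) \<and>
     (\<forall>f\<in>X. \<forall>\<epsilon>>0. \<exists>\<eta>>0. \<forall>h\<in>X.
        wnorm v (\<lambda>z. h z - f z) < \<eta> \<longrightarrow> wnorm w (\<lambda>z. T h z - T f z) < \<epsilon>)"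

text \<open>The derivatives are two-sided, so \<open>S\<close> is meant to be open.\<close>

definition C2_on :: "real set \<Rightarrow> (real \<Rightarrow> real) \<Rightarrow> bool" where
  "C2_on S w \<longleftrightarrow>
     (\<forall>r\<in>S. w differentiable (at r)) \<and>
     (\<forall>r\<in>S. deriv w differentiable (at r)) \<and>
     continuous_on S (deriv (deriv w))"

end

theory Submission
  imports Defs
begin

text \<open>
  The function \<open>Volterra g f\<close> is the primitive of \<open>f * deriv g\<close> that vanishes at zero. The theorem
  thus compares the size of an entire function \<open>F\<close> in the space with weight \<open>w\<close> with the size of its
  derivative, and the comparison is that \<open>F\<close> is of order \<open>1 / w\<close> exactly when its derivative is of
  order \<open>\<bar>deriv w\<bar> / w\<^sup>2\<close>, which is the derivative of \<open>1 / w\<close>.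

  From the derivative to the function one integrates along rays
  (\<open>weighted_growth_from_derivative\<close>). For \<open>f\<close> in the unit ball, \<open>\<bar>f\<bar>\<close> is at most the reciprocal of
  the associated weight, so the supremum condition on \<open>g\<close> bounds \<open>f * deriv g\<close> by a multiple of
  \<open>\<bar>deriv w\<bar> / w\<^sup>2\<close>, and the operator is bounded on \<open>Hinf v\<close>. That it maps \<open>Hzero v\<close> into
  \<open>Hzero w\<close> follows by the same integration once the product of \<open>f\<close> and the associated weight is
  known to vanish at infinity. This holds for \<open>f\<close> in \<open>Hzero v\<close>, because polynomials are dense there
  (\<open>assoc_weight_tendsto_Hzero\<close>).

  From the function to the derivative one uses a Cauchy estimate
  (\<open>weighted_derivative_estimate\<close>). The monotonicity of \<open>\<bar>deriv w r\<bar> * r powr (1 + \<delta>)\<close> makes \<open>w\<close>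
  convex on \<open>]R, \<infinity>[\<close>, so \<open>w\<close> lies above its tangents and keeps half of its value over the distance
  \<open>w / (2 * \<bar>deriv w\<bar>)\<close>; a Cauchy estimate with this radius loses only a constant factor. It is
  applied to the image of a function \<open>f\<close> whose value at the given point nearly attains the supremum
  in the associated weight. Dilations \<open>z \<mapsto> f (r * z)\<close> provide such an \<open>f\<close> inside \<open>Hzero v\<close>
  (\<open>almost_extremal_in_Hzero\<close>), so that continuity on either space implies the condition on \<open>g\<close>.
\<close>

section \<open>Weighted spaces of entire functions\<close>

lemma weight_pos: "weight v \<Longrightarrow> 0 \<le> r \<Longrightarrow> 0 < v r"
  by (simp add: weight_def)

lemma weight_antimono: "weight v \<Longrightarrow> 0 \<le> r \<Longrightarrow> r \<le> s \<Longrightarrow> v s \<le> v r"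
  by (auto simp: weight_def monotone_on_def)

lemma HinfI:
  assumes "f holomorphic_on UNIV" "\<And>z. v (cmod z) * cmod (f z) \<le> B"
  shows "f \<in> Hinf v"
  using assms by (auto simp: Hinf_def bdd_above_def)

lemma wnorm_le:
  assumes "\<And>z. v (cmod z) * cmod (f z) \<le> B"
  shows "wnorm v f \<le> B"
  unfolding wnorm_def using assms by (intro cSUP_least) auto

lemma le_wnorm:
  assumes "f \<in> Hinf v"
  shows "v (cmod z) * cmod (f z) \<le> wnorm v f"
  using assms unfolding Hinf_def wnorm_def by (intro cSUP_upper) auto

lemma wnorm_nonneg:
  assumes "weight v" "f \<in> Hinf v"
  shows "0 \<le> wnorm v f"
proof -
  have "0 \<le> v (cmod 0) * cmod (f 0)"
    using weight_pos[OF assms(1), of 0] by simp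
  also have "\<dots> \<le> wnorm v f"
    by (rule le_wnorm[OF assms(2)])
  finally show ?thesis .
qed

lemma Hinf_diff:
  assumes "weight v" "f \<in> Hinf v" "h \<in> Hinf v"
  shows "(\<lambda>z. h z - f z) \<in> Hinf v"
proof (rule HinfI)
  show "(\<lambda>z. h z - f z) holomorphic_on UNIV"
    using assms by (auto simp: Hinf_def intro!: holomorphic_intros)
  fix z
  have "v (cmod z) * cmod (h z - f z) \<le> v (cmod z) * (cmod (h z) + cmod (f z))"
    using weight_pos[OF assms(1), of "cmod z"] norm_triangle_ineq4[of "h z" "f z"]
    by (intro mult_left_mono) auto
  also have "\<dots> \<le> wnorm v h + wnorm v f"
    using le_wnorm[OF assms(2), of z] le_wnorm[OF assms(3), of z] by (simp add: algebra_simps)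
  finally show "v (cmod z) * cmod (h z - f z) \<le> wnorm v h + wnorm v f" .
qed

lemma Hinf_scale:
  assumes "f \<in> Hinf v" "0 \<le> c"
  shows "(\<lambda>z. complex_of_real c * f z) \<in> Hinf v"
    and "wnorm v (\<lambda>z. complex_of_real c * f z) \<le> c * wnorm v f"
proof -
  have *: "v (cmod z) * cmod (complex_of_real c * f z) \<le> c * wnorm v f" for z
    using mult_left_mono[OF le_wnorm[OF assms(1), of z] assms(2)] assms(2)
    by (simp add: norm_mult mult_ac)
  show "wnorm v (\<lambda>z. complex_of_real c * f z) \<le> c * wnorm v f"
    using * by (rule wnorm_le)
  show "(\<lambda>z. complex_of_real c * f z) \<in> Hinf v"
    using assms * by (intro HinfI[where B = "c * wnorm v f"])
      (auto simp: Hinf_def intro!: holomorphic_intros)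
qed

lemma Hzero_scale:
  assumes "f \<in> Hzero v"
  shows "(\<lambda>z. complex_of_real c * f z) \<in> Hzero v"
proof -
  have "((\<lambda>z. \<bar>c\<bar> * (v (cmod z) * cmod (f z))) \<longlongrightarrow> \<bar>c\<bar> * 0) at_infinity"
    using assms by (intro tendsto_intros) (simp add: Hzero_def)
  then have "((\<lambda>z. v (cmod z) * cmod (complex_of_real c * f z)) \<longlongrightarrow> 0) at_infinity"
    by (simp add: norm_mult mult_ac)
  then show ?thesis
    using assms by (auto simp: Hzero_def intro!: holomorphic_intros)
qed

lemma entire_bounded_on_disc:
  assumes "f holomorphic_on UNIV"
  shows "\<exists>D. \<forall>z. cmod z \<le> b \<longrightarrow> cmod (f z) \<le> D"
proof -
  have "compact (f ` cball 0 b)"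
    using assms by (intro compact_continuous_image holomorphic_on_imp_continuous_on)
      (auto intro: holomorphic_on_subset)
  then obtain D where "\<forall>x\<in>f ` cball 0 b. cmod x \<le> D"
    using compact_imp_bounded[of "f ` cball 0 b"] unfolding bounded_iff by blast
  then show ?thesis
    by (intro exI[of _ D]) auto
qed

lemma Hzero_subset_Hinf:
  assumes "weight v"
  shows "Hzero v \<subseteq> Hinf v"
proof
  fix f assume f: "f \<in> Hzero v"
  then have hol: "f holomorphic_on UNIV"
    and lim: "((\<lambda>z. v (cmod z) * cmod (f z)) \<longlongrightarrow> 0) at_infinity"
    by (auto simp: Hzero_def)
  obtain b where b: "\<And>z. b \<le> cmod z \<Longrightarrow> v (cmod z) * cmod (f z) < 1"
    using lim[unfolded Lim_at_infinity, rule_format, of 1] by fastforce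
  obtain D where D: "\<And>z. cmod z \<le> b \<Longrightarrow> cmod (f z) \<le> D"
    using entire_bounded_on_disc[OF hol, of b] by blast
  show "f \<in> Hinf v"
  proof (rule HinfI[OF hol])
    fix z
    have v0: "0 < v (cmod z)" "v (cmod z) \<le> v 0"
      using weight_pos[OF assms] weight_antimono[OF assms] by auto
    show "v (cmod z) * cmod (f z) \<le> max 1 (v 0 * D)"
    proof (cases "cmod z \<le> b")
      case True
      then have "v (cmod z) * cmod (f z) \<le> v 0 * D"
        using D[OF True] v0 by (intro mult_mono) auto
      then show ?thesis by simp
    next
      case False
      then show ?thesis using b[of z] by simp
    qed
  qed
qed

lemma Hzero_diff:
  assumes "weight v" "f \<in> Hzero v" "h \<in> Hzero v"
  shows "(\<lambda>z. h z - f z) \<in> Hzero v"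
proof -
  have "((\<lambda>z. v (cmod z) * cmod (h z) + v (cmod z) * cmod (f z)) \<longlongrightarrow> 0 + 0) at_infinity"
    using assms by (intro tendsto_add) (simp_all add: Hzero_def)
  then have "((\<lambda>z. v (cmod z) * cmod (h z) + v (cmod z) * cmod (f z)) \<longlongrightarrow> 0) at_infinity"
    by simp
  then have "((\<lambda>z. v (cmod z) * cmod (h z - f z)) \<longlongrightarrow> 0) at_infinity"
  proof (rule tendsto_0_le[where K = 1])
    show "\<forall>\<^sub>F z in at_infinity. norm (v (cmod z) * cmod (h z - f z))
            \<le> norm (v (cmod z) * cmod (h z) + v (cmod z) * cmod (f z)) * 1"
    proof (rule always_eventually, rule allI)
      fix z
      have "v (cmod z) * cmod (h z - f z) \<le> v (cmod z) * (cmod (h z) + cmod (f z))"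
        using weight_pos[OF assms(1), of "cmod z"] norm_triangle_ineq4[of "h z" "f z"]
        by (intro mult_left_mono) auto
      moreover have "0 \<le> v (cmod z) * cmod (h z - f z)"
        using weight_pos[OF assms(1), of "cmod z"] by simp
      ultimately show "norm (v (cmod z) * cmod (h z - f z))
            \<le> norm (v (cmod z) * cmod (h z) + v (cmod z) * cmod (f z)) * 1"
        by (simp add: algebra_simps)
    qed
  qed
  then show ?thesis
    using assms by (auto simp: Hzero_def intro!: holomorphic_intros)
qed

section \<open>The associated weight\<close>

lemma bdd_above_unit_ball_values:
  assumes "weight v"
  shows "bdd_above ((\<lambda>f. cmod (f z)) ` {f \<in> Hinf v. wnorm v f \<le> 1})"
proof (rule bdd_aboveI2)
  fix f assume "f \<in> {f \<in> Hinf v. wnorm v f \<le> 1}"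
  then have "v (cmod z) * cmod (f z) \<le> 1"
    using le_wnorm[of f v z] by simp
  then show "cmod (f z) \<le> 1 / v (cmod z)"
    using weight_pos[OF assms, of "cmod z"] by (simp add: field_simps)
qed

lemma assoc_weight_pos:
  assumes "weight v"
  shows "0 < assoc_weight v z"
proof -
  let ?k = "\<lambda>z::complex. complex_of_real (1 / v 0)"
  have v0: "0 < v 0"
    using weight_pos[OF assms, of 0] by simp
  have *: "v (cmod z) * cmod (?k z) \<le> 1" for z
    using v0 weight_pos[OF assms, of "cmod z"] weight_antimono[OF assms, of 0 "cmod z"]
    by (simp add: norm_divide)
  have "?k \<in> {f \<in> Hinf v. wnorm v f \<le> 1}"
    using * by (auto intro!: HinfI[where B = 1] wnorm_le)
  then have "cmod (?k z) \<le> (SUP f\<in>{f \<in> Hinf v. wnorm v f \<le> 1}. cmod (f z))"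
    by (rule cSUP_upper) (rule bdd_above_unit_ball_values[OF assms])
  moreover have "0 < cmod (?k z)"
    using v0 by simp
  ultimately show ?thesis
    unfolding assoc_weight_def by (simp only: inverse_positive_iff_positive)
qed

lemma assoc_weight_bound:
  assumes v: "weight v" and f: "f holomorphic_on UNIV"
    and B: "\<And>z. v (cmod z) * cmod (f z) \<le> B"
  shows "assoc_weight v z * cmod (f z) \<le> B"
proof (rule field_le_epsilon)
  \<comment> \<open>Passing to \<open>B + e\<close> allows the normalization of \<open>f\<close> also when \<open>B = 0\<close>.\<close>
  fix e :: real assume "0 < e"
  have "0 \<le> v (cmod 0) * cmod (f 0)"
    using weight_pos[OF v, of 0] by simp
  then have D: "0 < B + e"
    using B[of 0] \<open>0 < e\<close> by linarith
  have fB: "v (cmod x) * cmod (f x) \<le> B + e" for x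
    using B[of x] \<open>0 < e\<close> by linarith
  let ?h = "\<lambda>x. f x / complex_of_real (B + e)"
  have *: "v (cmod x) * cmod (?h x) \<le> 1" for x
  proof -
    have "cmod (?h x) = cmod (f x) / (B + e)"
      using D by (simp only: norm_divide norm_of_real abs_of_pos)
    then have "v (cmod x) * cmod (?h x) = v (cmod x) * cmod (f x) / (B + e)"
      by simp
    also have "\<dots> \<le> 1"
      using fB[of x] D by (simp add: divide_le_eq)
    finally show ?thesis .
  qed
  have "complex_of_real (B + e) \<noteq> 0"
    using D by (simp only: of_real_eq_0_iff)
  then have "?h holomorphic_on UNIV"
    using f by (intro holomorphic_on_divide holomorphic_on_const)
  then have "?h \<in> {f \<in> Hinf v. wnorm v f \<le> 1}"
    using * by (auto intro!: HinfI[where B = 1] wnorm_le simp del: of_real_add)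
  then have "cmod (?h z) \<le> (SUP f\<in>{f \<in> Hinf v. wnorm v f \<le> 1}. cmod (f z))"
    by (rule cSUP_upper) (rule bdd_above_unit_ball_values[OF v])
  also have "\<dots> = 1 / assoc_weight v z"
    unfolding assoc_weight_def by (simp add: inverse_eq_divide)
  finally have "cmod (f z) / (B + e) \<le> 1 / assoc_weight v z"
    using D by (simp only: norm_divide norm_of_real abs_of_pos)
  then show "assoc_weight v z * cmod (f z) \<le> B + e"
    using D assoc_weight_pos[OF v, of z] by (simp add: field_simps)
qed

section \<open>Dilations and polynomial approximation\<close>

lemma tendsto_weighted_polynomial:
  fixes u :: "complex \<Rightarrow> real" and c :: "nat \<Rightarrow> complex"
  assumes u: "\<And>z. 0 \<le> u z"
    and lim: "\<And>n. ((\<lambda>z. u z * cmod z ^ n) \<longlongrightarrow> 0) at_infinity"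
  shows "((\<lambda>z. u z * cmod (\<Sum>n<N. c n * z ^ n)) \<longlongrightarrow> 0) at_infinity"
proof -
  have "((\<lambda>z. \<Sum>n<N. cmod (c n) * (u z * cmod z ^ n)) \<longlongrightarrow> (\<Sum>n<N. cmod (c n) * 0)) at_infinity"
    by (intro tendsto_intros lim)
  then have "((\<lambda>z. \<Sum>n<N. cmod (c n) * (u z * cmod z ^ n)) \<longlongrightarrow> 0) at_infinity"
    by simp
  then show ?thesis
  proof (rule tendsto_0_le[where K = 1], intro always_eventually allI)
    fix z
    have "u z * cmod (\<Sum>n<N. c n * z ^ n) \<le> u z * (\<Sum>n<N. cmod (c n * z ^ n))"
      by (intro mult_left_mono norm_sum u)
    also have "\<dots> = (\<Sum>n<N. cmod (c n) * (u z * cmod z ^ n))"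
      by (simp add: sum_distrib_left norm_mult norm_power mult_ac)
    finally show "norm (u z * cmod (\<Sum>n<N. c n * z ^ n))
        \<le> norm (\<Sum>n<N. cmod (c n) * (u z * cmod z ^ n)) * 1"
      using u[of z] by simp
  qed
qed

lemma weight_tendsto_monomial:
  assumes "weight v"
  shows "((\<lambda>z::complex. v (cmod z) * cmod z ^ n) \<longlongrightarrow> 0) at_infinity"
proof -
  have "((\<lambda>r. r ^ n * v r) \<longlongrightarrow> 0) at_top"
    using assms by (simp add: weight_def)
  from filterlim_compose[OF this filterlim_norm_at_top]
  show ?thesis by (simp add: mult.commute)
qed

text \<open>
  The associated weight dominates \<open>v\<close>, so the decay of \<open>v\<close> does not pass to it by comparison. It
  does decay rapidly because \<open>z ^ Suc n\<close> lies in the weighted space: this bounds the associated weight times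
  \<open>cmod z ^ Suc n\<close>, and the additional power of \<open>z\<close> yields the limit.
\<close>

lemma assoc_weight_tendsto_monomial:
  assumes v: "weight v"
  shows "((\<lambda>z. assoc_weight v z * cmod z ^ n) \<longlongrightarrow> 0) at_infinity"
proof -
  have "((\<lambda>z::complex. v (cmod z) * cmod (z ^ Suc n)) \<longlongrightarrow> 0) at_infinity"
    using weight_tendsto_monomial[OF v, of "Suc n"] by (simp add: norm_power norm_mult)
  moreover have "(\<lambda>z. z ^ Suc n) holomorphic_on UNIV"
    by (intro holomorphic_intros)
  ultimately have "(\<lambda>z. z ^ Suc n) \<in> Hzero v"
    unfolding Hzero_def by blast
  then have mem: "(\<lambda>z. z ^ Suc n) \<in> Hinf v"
    using Hzero_subset_Hinf[OF v] by blast
  define D where "D = wnorm v (\<lambda>z. z ^ Suc n)"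
  have D: "assoc_weight v z * cmod (z ^ Suc n) \<le> D" for z
    unfolding D_def using mem
    by (intro assoc_weight_bound[OF v] le_wnorm) (auto intro!: holomorphic_intros)
  have "((\<lambda>z::complex. inverse z) \<longlongrightarrow> 0) at_infinity"
    by (rule tendsto_inverse_0)
  then show ?thesis
  proof (rule tendsto_0_le[where K = D])
    have "\<forall>\<^sub>F z::complex in at_infinity. 1 \<le> cmod z"
      unfolding eventually_at_infinity by auto
    then show "\<forall>\<^sub>F z in at_infinity. norm (assoc_weight v z * cmod z ^ n) \<le> norm (inverse z) * D"
    proof eventually_elim
      case (elim z)
      then have z: "0 < cmod z" by linarith
      have "assoc_weight v z * cmod z ^ n \<le> D / cmod z"
        using D[of z] z by (simp add: pos_le_divide_eq norm_mult norm_power mult_ac)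
      also have "\<dots> = norm (inverse z) * D"
        by (simp add: norm_inverse divide_inverse_commute)
      finally have "assoc_weight v z * cmod z ^ n \<le> norm (inverse z) * D" .
      then show "norm (assoc_weight v z * cmod z ^ n) \<le> norm (inverse z) * D"
        using assoc_weight_pos[OF v, of z] by simp
    qed
  qed
qed

text \<open>
  The Cauchy inequality on the circle through \<open>z\<close> bounds the \<open>n\<close>-th Taylor monomial of \<open>f\<close> at \<open>z\<close>
  by the maximum of \<open>f\<close> on that circle. Hence no monomial has a larger weighted norm than
  \<open>f\<close>, and after a dilation the Taylor series converges geometrically in the weighted norm.
\<close>

lemma taylor_monomial_weighted_bound:
  assumes v: "weight v" and f: "f holomorphic_on UNIV"
    and B: "\<And>z. v (cmod z) * cmod (f z) \<le> B"
  shows "v (cmod z) * cmod ((deriv ^^ n) f 0 / fact n * z ^ n) \<le> B"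
proof (cases "z = 0")
  case True
  have "0 \<le> v (cmod 0) * cmod (f 0)"
    using weight_pos[OF v, of 0] by simp
  then have "0 \<le> B"
    using B[of 0] by linarith
  then show ?thesis
    using True B[of 0] by (cases n) auto
next
  case False
  have vz: "0 < v (cmod z)"
    using weight_pos[OF v] by simp
  have "cmod ((deriv ^^ n) f 0) \<le> fact n * (B / v (cmod z)) / cmod z ^ n"
  proof (rule Cauchy_inequality)
    show "f holomorphic_on ball 0 (cmod z)"
      using f by (rule holomorphic_on_subset) auto
    show "continuous_on (cball 0 (cmod z)) f"
      using f by (intro holomorphic_on_imp_continuous_on) (auto intro: holomorphic_on_subset)
    show "cmod (f x) \<le> B / v (cmod z)" if "cmod (0 - x) = cmod z" for x
      using that B[of x] vz by (simp add: field_simps)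
  qed (use False in auto)
  then have "cmod ((deriv ^^ n) f 0) * cmod z ^ n * v (cmod z) \<le> fact n * B"
    using False vz by (simp add: field_simps)
  then show ?thesis
    by (simp add: norm_mult norm_divide norm_power field_simps)
qed

lemma dilated_taylor_weighted_bound:
  assumes v: "weight v" and f: "f holomorphic_on UNIV"
    and B: "\<And>z. v (cmod z) * cmod (f z) \<le> B" and r: "0 \<le> r" "r < 1"
  shows "v (cmod z) * cmod (f (of_real r * z)
           - (\<Sum>n<N. ((deriv ^^ n) f 0 / fact n * of_real r ^ n) * z ^ n)) \<le> B * r ^ N / (1 - r)"
proof -
  define a where "a n = (deriv ^^ n) f 0 / fact n * of_real r ^ n * z ^ n" for n
  have vz: "0 < v (cmod z)"
    using weight_pos[OF v] by simp
  have "(\<lambda>n. (deriv ^^ n) f 0 / fact n * (of_real r * z - 0) ^ n) sums f (of_real r * z)"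
    by (rule holomorphic_power_series[where r = "cmod (of_real r * z) + 1"])
      (auto intro: holomorphic_on_subset[OF f])
  then have "a sums f (of_real r * z)"
    by (simp add: a_def[abs_def] power_mult_distrib mult_ac)
  then have "(\<lambda>n. a (n + N)) sums (f (of_real r * z) - (\<Sum>n<N. a n))"
    by (simp add: sums_iff_shift)
  then have s1: "(\<lambda>n. of_real (v (cmod z)) * a (n + N)) sums
      (of_real (v (cmod z)) * (f (of_real r * z) - (\<Sum>n<N. a n)))"
    by (rule sums_mult)
  have "(\<lambda>n. r ^ n) sums (1 / (1 - r))"
    using r by (intro geometric_sums) auto
  then have s2: "(\<lambda>n. B * r ^ N * r ^ n) sums (B * r ^ N * (1 / (1 - r)))"
    by (rule sums_mult)
  have bnd: "norm (of_real (v (cmod z)) * a (n + N)) \<le> B * r ^ N * r ^ n" for n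
  proof -
    have "norm (of_real (v (cmod z)) * a (n + N))
        = r ^ (n + N) * (v (cmod z) * cmod ((deriv ^^ (n + N)) f 0 / fact (n + N) * z ^ (n + N)))"
      using r vz by (simp add: a_def norm_mult norm_power norm_divide)
    also have "\<dots> \<le> r ^ (n + N) * B"
      using r by (intro mult_left_mono taylor_monomial_weighted_bound[OF v f B]) auto
    finally show ?thesis
      by (simp add: power_add mult_ac)
  qed
  have "norm (of_real (v (cmod z)) * (f (of_real r * z) - (\<Sum>n<N. a n)))
      \<le> B * r ^ N * (1 / (1 - r))"
    using s1 s2 bnd by (rule norm_sums_le)
  then show ?thesis
    using vz by (simp add: norm_mult a_def)
qed

lemma dilated_polynomial_approximation:
  assumes v: "weight v" and f: "f \<in> Hinf v" and r: "0 \<le> r" "r < 1" and e: "0 < e"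
  obtains c :: "nat \<Rightarrow> complex" and N where
    "\<And>z. v (cmod z) * cmod (f (of_real r * z) - (\<Sum>n<N. c n * z ^ n)) \<le> e"
proof -
  have hol: "f holomorphic_on UNIV"
    using f by (simp add: Hinf_def)
  define B where "B = wnorm v f"
  have "(\<lambda>N. B * r ^ N / (1 - r)) \<longlonglongrightarrow> B * 0 / (1 - r)"
    using r by (intro tendsto_intros LIMSEQ_power_zero) auto
  then have "\<forall>\<^sub>F N in sequentially. B * r ^ N / (1 - r) < e"
    using e by (intro order_tendstoD) auto
  then obtain N where N: "B * r ^ N / (1 - r) < e"
    by (auto simp: eventually_sequentially)
  have "v (cmod z) * cmod (f (of_real r * z)
      - (\<Sum>n<N. ((deriv ^^ n) f 0 / fact n * of_real r ^ n) * z ^ n)) \<le> e" for z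
    using dilated_taylor_weighted_bound[OF v hol le_wnorm[OF f] r, where N = N and z = z] N
    by (simp add: B_def)
  then show ?thesis
    by (rule that)
qed

lemma dilation_in_Hzero:
  assumes v: "weight v" and f: "f \<in> Hinf v" and r: "0 \<le> r" "r < 1"
  shows "(\<lambda>z. f (of_real r * z)) \<in> Hzero v"
proof -
  have hol: "f holomorphic_on UNIV"
    using f by (simp add: Hinf_def)
  have "((\<lambda>z. v (cmod z) * cmod (f (of_real r * z))) \<longlongrightarrow> 0) at_infinity"
    unfolding Lim_at_infinity
  proof (intro allI impI)
    fix e :: real assume e: "0 < e"
    obtain c N where c: "\<And>z. v (cmod z) * cmod (f (of_real r * z) - (\<Sum>n<N. c n * z ^ n)) \<le> e / 2"
      using dilated_polynomial_approximation[OF v f r, of "e / 2"] e by auto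
    have "((\<lambda>z. v (cmod z) * cmod (\<Sum>n<N. c n * z ^ n)) \<longlongrightarrow> 0) at_infinity"
      using weight_pos[OF v] weight_tendsto_monomial[OF v]
      by (intro tendsto_weighted_polynomial) (auto intro: less_imp_le)
    then obtain b where b:
      "\<And>z. b \<le> cmod z \<Longrightarrow> dist (v (cmod z) * cmod (\<Sum>n<N. c n * z ^ n)) 0 < e / 2"
      unfolding Lim_at_infinity using e by (meson half_gt_zero)
    have "dist (v (cmod z) * cmod (f (of_real r * z))) 0 < e" if z: "b \<le> cmod z" for z
    proof -
      let ?p = "\<Sum>n<N. c n * z ^ n"
      have vz: "0 < v (cmod z)"
        using weight_pos[OF v] by simp
      have "v (cmod z) * cmod (f (of_real r * z))
          \<le> v (cmod z) * (cmod (f (of_real r * z) - ?p) + cmod ?p)"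
        using vz norm_triangle_ineq[of "f (of_real r * z) - ?p" ?p]
        by (intro mult_left_mono) auto
      also have "\<dots> < e"
        using c[of z] b[OF z] vz by (simp add: algebra_simps)
      finally show ?thesis
        using vz by simp
    qed
    then show "\<exists>b. \<forall>z. b \<le> cmod z \<longrightarrow> dist (v (cmod z) * cmod (f (of_real r * z))) 0 < e"
      by blast
  qed
  moreover have "(\<lambda>z. f (of_real r * z)) holomorphic_on UNIV"
    using holomorphic_on_compose_gen[OF _ hol, of "\<lambda>z. of_real r * z" UNIV]
    by (simp add: o_def holomorphic_intros)
  ultimately show ?thesis
    by (simp add: Hzero_def)
qed

lemma dilation_weighted_le:
  assumes v: "weight v" and r: "0 \<le> r" "r \<le> 1"
  shows "v (cmod z) * cmod (f (of_real r * z))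
      \<le> v (cmod (of_real r * z)) * cmod (f (of_real r * z))"
proof -
  have "r * cmod z \<le> cmod z"
    using r by (simp add: mult_left_le_one_le)
  then have "v (cmod z) \<le> v (cmod (of_real r * z))"
    using r by (intro weight_antimono[OF v]) (auto simp: norm_mult)
  then show ?thesis
    by (intro mult_right_mono) auto
qed

lemma dilation_approximation:
  assumes v: "weight v" and f: "f \<in> Hzero v" and e: "0 < e"
  obtains r where "0 \<le> r" "r < 1"
    "\<And>z. v (cmod z) * cmod (f z - f (of_real r * z)) \<le> e"
proof -
  have hol: "f holomorphic_on UNIV"
    and lim: "((\<lambda>z. v (cmod z) * cmod (f z)) \<longlongrightarrow> 0) at_infinity"
    using f by (auto simp: Hzero_def)
  obtain b0 where b0: "\<And>z. b0 \<le> cmod z \<Longrightarrow> dist (v (cmod z) * cmod (f z)) 0 < e / 2"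
    using lim e unfolding Lim_at_infinity by (meson half_gt_zero)
  define b where "b = max b0 1"
  have bpos: "0 < b"
    by (simp add: b_def)
  have b: "v (cmod z) * cmod (f z) < e / 2" if "b \<le> cmod z" for z
    using b0[of z] that by (auto simp: b_def)
  have v0: "0 < v 0"
    using weight_pos[OF v] by simp
  have "uniformly_continuous_on (cball 0 (2 * b)) f"
    using hol by (intro compact_uniformly_continuous holomorphic_on_imp_continuous_on)
      (auto intro: holomorphic_on_subset)
  moreover have "0 < e / v 0"
    using e v0 by simp
  ultimately obtain d where d: "0 < d"
    "\<And>x y. x \<in> cball 0 (2 * b) \<Longrightarrow> y \<in> cball 0 (2 * b) \<Longrightarrow> dist y x < d \<Longrightarrow> dist (f y) (f x) < e / v 0"
    unfolding uniformly_continuous_on_def by meson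
  \<comment> \<open>With \<open>r \<ge> 1 / 2\<close>, points outside the disc of radius \<open>2 * b\<close> stay outside the one of radius
    \<open>b\<close>, where \<open>v * \<bar>f\<bar>\<close> is small; with \<open>1 - r \<le> d / (4 * b)\<close>, points of the larger disc move by
    less than \<open>d\<close>.\<close>
  define r where "r = max (1 / 2) (1 - d / (4 * b))"
  have r: "1 / 2 \<le> r" "r < 1" "1 - r \<le> d / (4 * b)"
    using d(1) bpos by (auto simp: r_def)
  have "v (cmod z) * cmod (f z - f (of_real r * z)) \<le> e" for z
  proof (cases "2 * b \<le> cmod z")
    case True
    have vz: "0 < v (cmod z)"
      using weight_pos[OF v] by simp
    have "1 / 2 * cmod z \<le> r * cmod z"
      using r by (intro mult_right_mono) auto
    then have rz: "b \<le> cmod (of_real r * z)"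
      using r True by (simp add: norm_mult)
    have "v (cmod z) * cmod (f (of_real r * z))
        \<le> v (cmod (of_real r * z)) * cmod (f (of_real r * z))"
      using r by (intro dilation_weighted_le[OF v]) auto
    moreover have "v (cmod z) * cmod (f z - f (of_real r * z))
        \<le> v (cmod z) * (cmod (f z) + cmod (f (of_real r * z)))"
      using vz by (intro mult_left_mono norm_triangle_ineq4) auto
    moreover have "v (cmod z) * cmod (f z) < e / 2"
      using True bpos by (intro b) auto
    ultimately show ?thesis
      using b[OF rz] by (simp add: algebra_simps)
  next
    case False
    have "r * cmod z \<le> cmod z"
      using r by (simp add: mult_left_le_one_le)
    then have "cmod (of_real r * z) \<le> 2 * b"
      using False r by (simp add: norm_mult)
    moreover have "dist z (of_real r * z) < d"
    proof -
      have "dist z (of_real r * z) = cmod (of_real (1 - r) * z)"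
        by (simp add: dist_norm algebra_simps)
      also have "\<dots> = (1 - r) * cmod z"
        using r by (simp only: norm_mult norm_of_real abs_of_pos diff_gt_0_iff_gt)
      also have "\<dots> \<le> d / (4 * b) * (2 * b)"
        using r False d(1) bpos by (intro mult_mono) auto
      also have "\<dots> < d"
        using d(1) bpos by (simp add: field_simps)
      finally show ?thesis .
    qed
    ultimately have "cmod (f z - f (of_real r * z)) \<le> e / v 0"
      using d(2)[of "of_real r * z" z] False by (auto simp: dist_norm)
    then have "v (cmod z) * cmod (f z - f (of_real r * z)) \<le> v 0 * (e / v 0)"
      using weight_pos[OF v, of "cmod z"] weight_antimono[OF v, of 0 "cmod z"]
      by (intro mult_mono) auto
    then show ?thesis
      using v0 by simp
  qed
  then show ?thesis
    using r by (intro that[of r]) auto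
qed

text \<open>
  Polynomials are dense in \<open>Hzero v\<close>, by dilation and Taylor expansion. An error measured with
  \<open>v\<close> stays the same when measured with the associated weight, and on polynomials the latter
  decays; hence membership in \<open>Hzero v\<close> is inherited by the larger associated weight.
\<close>

lemma assoc_weight_tendsto_Hzero:
  assumes v: "weight v" and f: "f \<in> Hzero v"
  shows "((\<lambda>z. assoc_weight v z * cmod (f z)) \<longlongrightarrow> 0) at_infinity"
  unfolding Lim_at_infinity
proof (intro allI impI)
  fix e :: real assume e: "0 < e"
  have hol: "f holomorphic_on UNIV" and inf: "f \<in> Hinf v"
    using f Hzero_subset_Hinf[OF v] by (auto simp: Hzero_def)
  obtain r where r: "0 \<le> r" "r < 1"
    and fr: "\<And>z. v (cmod z) * cmod (f z - f (of_real r * z)) \<le> e / 4"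
    using dilation_approximation[OF v f, of "e / 4"] e by auto
  obtain c N where c: "\<And>z. v (cmod z) * cmod (f (of_real r * z) - (\<Sum>n<N. c n * z ^ n)) \<le> e / 4"
    using dilated_polynomial_approximation[OF v inf r, of "e / 4"] e by auto
  let ?p = "\<lambda>z. \<Sum>n<N. c n * z ^ n"
  have "v (cmod z) * cmod (f z - ?p z) \<le> e / 2" for z
  proof -
    have "v (cmod z) * cmod (f z - ?p z)
        \<le> v (cmod z) * (cmod (f z - f (of_real r * z)) + cmod (f (of_real r * z) - ?p z))"
      using weight_pos[OF v, of "cmod z"]
        norm_triangle_ineq[of "f z - f (of_real r * z)" "f (of_real r * z) - ?p z"]
      by (intro mult_left_mono) auto
    also have "\<dots> \<le> e / 2"
      using fr[of z] c[of z] by (simp add: algebra_simps)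
    finally show ?thesis .
  qed
  then have app: "assoc_weight v z * cmod (f z - ?p z) \<le> e / 2" for z
    using hol by (intro assoc_weight_bound[OF v]) (auto intro!: holomorphic_intros)
  have "((\<lambda>z. assoc_weight v z * cmod (?p z)) \<longlongrightarrow> 0) at_infinity"
    using assoc_weight_pos[OF v] assoc_weight_tendsto_monomial[OF v]
    by (intro tendsto_weighted_polynomial) (auto intro: less_imp_le)
  then obtain b where b: "\<And>z. b \<le> cmod z \<Longrightarrow> dist (assoc_weight v z * cmod (?p z)) 0 < e / 2"
    unfolding Lim_at_infinity using e by (meson half_gt_zero)
  have "dist (assoc_weight v z * cmod (f z)) 0 < e" if z: "b \<le> cmod z" for z
  proof -
    have vz: "0 < assoc_weight v z"
      using assoc_weight_pos[OF v] by simp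
    have "assoc_weight v z * cmod (f z)
        \<le> assoc_weight v z * (cmod (f z - ?p z) + cmod (?p z))"
      using vz norm_triangle_ineq[of "f z - ?p z" "?p z"]
      by (intro mult_left_mono) auto
    also have "\<dots> < e"
      using app[of z] b[OF z] vz by (simp add: algebra_simps)
    finally show ?thesis
      using vz by simp
  qed
  then show "\<exists>b. \<forall>z. b \<le> cmod z \<longrightarrow> dist (assoc_weight v z * cmod (f z)) 0 < e"
    by blast
qed

text \<open>
  The supremum defining the associated weight runs over the unit ball of \<open>Hinf v\<close>. A dilation
  moves a nearly extremal function into \<open>Hzero v\<close> without increasing its norm and changes its
  value at \<open>z\<close> by an arbitrarily small amount. This is why the small space also detects the
  associated weight.
\<close>

lemma almost_extremal_in_Hzero:
  assumes v: "weight v"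
  obtains f where "f \<in> Hzero v" "wnorm v f \<le> 1" "1 / 2 < assoc_weight v z * cmod (f z)"
proof -
  let ?U = "{f \<in> Hinf v. wnorm v f \<le> 1}"
  have apos: "0 < assoc_weight v z"
    by (rule assoc_weight_pos[OF v])
  have sup: "(SUP f\<in>?U. cmod (f z)) = 1 / assoc_weight v z"
    unfolding assoc_weight_def by (simp add: inverse_eq_divide)
  have "(\<lambda>z. 0) \<in> ?U"
    by (auto intro!: HinfI[where B = 0] wnorm_le)
  then have "\<exists>f\<in>?U. 1 / (2 * assoc_weight v z) < cmod (f z)"
    using apos bdd_above_unit_ball_values[OF v, of z]
    by (subst less_cSUP_iff[symmetric]) (auto simp: sup field_simps)
  then obtain f where f: "f \<in> Hinf v" "wnorm v f \<le> 1" "1 / (2 * assoc_weight v z) < cmod (f z)"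
    by blast
  have hol: "f holomorphic_on UNIV"
    using f by (simp add: Hinf_def)
  have "isCont f z"
    using hol holomorphic_on_imp_continuous_on continuous_on_eq_continuous_at by blast
  moreover have "((\<lambda>r. of_real r * z) \<longlongrightarrow> of_real 1 * z) (at_left (1::real))"
    by (intro tendsto_intros)
  ultimately have "((\<lambda>r. cmod (f (of_real r * z))) \<longlongrightarrow> cmod (f z)) (at_left (1::real))"
    by (intro tendsto_norm isCont_tendsto_compose[of z f]) auto
  then have "\<forall>\<^sub>F r in at_left (1::real). 1 / (2 * assoc_weight v z) < cmod (f (of_real r * z))"
    using f(3) by (rule order_tendstoD)
  moreover have "\<forall>\<^sub>F r in at_left (1::real). r \<in> {0<..<1}"
    by (rule eventually_at_left_real) simp
  ultimately have "\<forall>\<^sub>F r in at_left (1::real).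
      1 / (2 * assoc_weight v z) < cmod (f (of_real r * z)) \<and> r \<in> {0<..<1}"
    by (rule eventually_conj)
  then have "\<exists>r::real. 1 / (2 * assoc_weight v z) < cmod (f (of_real r * z)) \<and> r \<in> {0<..<1}"
    by (rule eventually_happens'[OF trivial_limit_at_left_real])
  then obtain r :: real where r: "0 < r" "r < 1"
    "1 / (2 * assoc_weight v z) < cmod (f (of_real r * z))"
    unfolding greaterThanLessThan_iff by blast
  show ?thesis
  proof (rule that)
    show "(\<lambda>z. f (of_real r * z)) \<in> Hzero v"
      using r by (intro dilation_in_Hzero[OF v f(1)]) auto
    show "wnorm v (\<lambda>z. f (of_real r * z)) \<le> 1"
    proof (rule wnorm_le)
      fix z
      have "v (cmod z) * cmod (f (of_real r * z))
          \<le> v (cmod (of_real r * z)) * cmod (f (of_real r * z))"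
        using r by (intro dilation_weighted_le[OF v]) auto
      also have "\<dots> \<le> 1"
        using le_wnorm[OF f(1), of "of_real r * z"] f(2) by linarith
      finally show "v (cmod z) * cmod (f (of_real r * z)) \<le> 1" .
    qed
    show "1 / 2 < assoc_weight v z * cmod (f (of_real r * z))"
      using r(3) apos by (simp add: field_simps)
  qed
qed

section \<open>The Volterra operator and continuity\<close>

lemma Volterra_primitive:
  assumes "f holomorphic_on UNIV" "g holomorphic_on UNIV"
  shows "(Volterra g f has_field_derivative f z * deriv g z) (at z)"
    and "Volterra g f 0 = 0"
proof -
  have "(\<lambda>z. f z * deriv g z) holomorphic_on UNIV"
    using assms by (intro holomorphic_intros) auto
  then obtain P where P: "\<And>x. (P has_field_derivative f x * deriv g x) (at x)"
    using holomorphic_convex_primitive'[of UNIV "\<lambda>z. f z * deriv g z"] by auto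
  have "Volterra g f x = P x - P 0" for x
    unfolding Volterra_def
    using contour_integral_primitive[of UNIV P "\<lambda>z. f z * deriv g z" "linepath 0 x"] P
    by (intro contour_integral_unique) auto
  then have eq: "Volterra g f = (\<lambda>x. P x - P 0)"
    by blast
  show "(Volterra g f has_field_derivative f z * deriv g z) (at z)"
    unfolding eq by (auto intro!: derivative_eq_intros P)
  show "Volterra g f 0 = 0"
    by (simp add: Volterra_def)
qed

lemma Volterra_holomorphic:
  assumes "f holomorphic_on UNIV" "g holomorphic_on UNIV"
  shows "Volterra g f holomorphic_on UNIV"
  using Volterra_primitive(1)[OF assms] by (auto simp: holomorphic_on_open)

lemma continuous_on_Volterra_integrand:
  assumes "f holomorphic_on UNIV" "g holomorphic_on UNIV"
  shows "continuous_on S (\<lambda>x. f x * deriv g x)"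
proof -
  have "(\<lambda>x. f x * deriv g x) holomorphic_on UNIV"
    using assms by (intro holomorphic_intros) auto
  then show ?thesis
    using holomorphic_on_imp_continuous_on continuous_on_subset by blast
qed

lemma Volterra_diff:
  assumes "f holomorphic_on UNIV" "h holomorphic_on UNIV" "g holomorphic_on UNIV"
  shows "Volterra g (\<lambda>z. h z - f z) z = Volterra g h z - Volterra g f z"
  unfolding Volterra_def left_diff_distrib using assms
  by (intro contour_integral_diff contour_integrable_continuous_linepath
      continuous_on_Volterra_integrand)

lemma Volterra_scale:
  assumes "f holomorphic_on UNIV" "g holomorphic_on UNIV"
  shows "Volterra g (\<lambda>z. c * f z) z = c * Volterra g f z"
  unfolding Volterra_def mult.assoc using assms
  by (intro contour_integral_lmul contour_integrable_continuous_linepath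
      continuous_on_Volterra_integrand)

text \<open>
  By linearity, continuity at \<open>f\<close> is an estimate for the difference \<open>h - f\<close>, and continuity at
  zero extends to the unit ball by scaling. So continuity and boundedness are interchangeable. The
  set \<open>X\<close> stands for either of the two spaces normed by \<open>wnorm v\<close>.
\<close>

lemma continuous_Volterra_if_bounded:
  assumes v: "weight v" and g: "g holomorphic_on UNIV" and X: "X \<subseteq> Hinf v"
    and diff: "\<And>f h. f \<in> X \<Longrightarrow> h \<in> X \<Longrightarrow> (\<lambda>z. h z - f z) \<in> X"
    and maps: "\<And>f. f \<in> X \<Longrightarrow> Volterra g f \<in> Y"
    and bound: "\<And>f. f \<in> X \<Longrightarrow> wnorm w (Volterra g f) \<le> K * wnorm v f"
  shows "continuous_operator v X w Y (Volterra g)"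
  unfolding continuous_operator_def
proof (intro conjI ballI allI impI)
  fix f and e :: real assume f: "f \<in> X" and e: "0 < e"
  define L where "L = max K 1"
  have L: "0 < L" "K \<le> L"
    by (auto simp: L_def)
  have "wnorm w (\<lambda>z. Volterra g h z - Volterra g f z) < e"
    if h: "h \<in> X" and small: "wnorm v (\<lambda>z. h z - f z) < e / L" for h
  proof -
    have eq: "(\<lambda>z. Volterra g h z - Volterra g f z) = Volterra g (\<lambda>z. h z - f z)"
      using f h X g by (intro ext Volterra_diff[symmetric]) (auto simp: Hinf_def)
    have "wnorm w (Volterra g (\<lambda>z. h z - f z)) \<le> K * wnorm v (\<lambda>z. h z - f z)"
      by (rule bound[OF diff[OF f h]])
    also have "\<dots> \<le> L * wnorm v (\<lambda>z. h z - f z)"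
      using L X diff[OF f h] by (intro mult_right_mono wnorm_nonneg[OF v]) auto
    also have "\<dots> < e"
      using small L by (simp add: field_simps)
    finally show ?thesis
      unfolding eq .
  qed
  moreover have "0 < e / L"
    using e L by simp
  ultimately show "\<exists>\<eta>>0. \<forall>h\<in>X. wnorm v (\<lambda>z. h z - f z) < \<eta> \<longrightarrow>
      wnorm w (\<lambda>z. Volterra g h z - Volterra g f z) < e"
    by blast
qed (rule maps)

lemma bounded_if_continuous_Volterra:
  assumes v: "weight v" and g: "g holomorphic_on UNIV" and X: "X \<subseteq> Hinf v" and Y: "Y \<subseteq> Hinf w"
    and zero: "(\<lambda>z. 0) \<in> X"
    and scale: "\<And>f c. f \<in> X \<Longrightarrow> 0 \<le> c \<Longrightarrow> (\<lambda>z. complex_of_real c * f z) \<in> X"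
    and cont: "continuous_operator v X w Y (Volterra g)"
  obtains K where "0 < K"
    "\<And>f z. f \<in> X \<Longrightarrow> wnorm v f \<le> 1 \<Longrightarrow> w (cmod z) * cmod (Volterra g f z) \<le> K"
proof -
  have V0: "Volterra g (\<lambda>z. 0) = (\<lambda>z. 0)"
    by (simp add: Volterra_def fun_eq_iff)
  have "\<exists>\<eta>>0. \<forall>h\<in>X. wnorm v (\<lambda>z. h z - 0) < \<eta> \<longrightarrow>
      wnorm w (\<lambda>z. Volterra g h z - Volterra g (\<lambda>z. 0) z) < 1"
    using conjunct2[OF cont[unfolded continuous_operator_def], rule_format, OF zero zero_less_one] .
  then obtain \<eta> where \<eta>: "0 < \<eta>"
    "\<And>h. h \<in> X \<Longrightarrow> wnorm v h < \<eta> \<Longrightarrow> wnorm w (Volterra g h) < 1"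
    unfolding V0 by auto
  show ?thesis
  proof (rule that)
    show "0 < 2 / \<eta>"
      using \<eta> by simp
    fix f z assume f: "f \<in> X" "wnorm v f \<le> 1"
    let ?h = "\<lambda>z. complex_of_real (\<eta> / 2) * f z"
    have hX: "?h \<in> X"
      using \<eta> f by (intro scale) auto
    have "wnorm v ?h \<le> \<eta> / 2 * wnorm v f"
      using X f \<eta> by (intro Hinf_scale) auto
    also have "\<dots> \<le> \<eta> / 2 * 1"
      using f \<eta> by (intro mult_left_mono) auto
    also have "\<dots> < \<eta>"
      using \<eta> by simp
    finally have "wnorm w (Volterra g ?h) < 1"
      by (rule \<eta>(2)[OF hX])
    moreover have "Volterra g ?h \<in> Hinf w"
      using cont hX Y unfolding continuous_operator_def by blast
    ultimately have "w (cmod z) * cmod (Volterra g ?h z) \<le> 1"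
      using le_wnorm[of "Volterra g ?h" w z] by linarith
    moreover have "Volterra g ?h z = complex_of_real (\<eta> / 2) * Volterra g f z"
      using f X g by (intro Volterra_scale) (auto simp: Hinf_def)
    moreover have "cmod (complex_of_real (\<eta> / 2) * Volterra g f z) = \<eta> / 2 * cmod (Volterra g f z)"
      using \<eta>(1) by (simp add: norm_mult)
    ultimately have "w (cmod z) * (\<eta> / 2 * cmod (Volterra g f z)) \<le> 1"
      by (simp only:)
    then show "w (cmod z) * cmod (Volterra g f z) \<le> 2 / \<eta>"
      using \<eta> by (simp add: field_simps)
  qed
qed

section \<open>Convexity of the target weight\<close>

lemma above_tangent_if_abs_deriv_antimono:
  assumes dw: "\<And>r. R < r \<Longrightarrow> (w has_real_derivative deriv w r) (at r)"
    and anti: "antimono_on {R<..} (\<lambda>r. \<bar>deriv w r\<bar>)"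
    and r: "R < r" and s: "0 \<le> s"
  shows "w r - s * \<bar>deriv w r\<bar> \<le> w (r + s)"
proof (cases "s = 0")
  case False
  then have "r < r + s"
    using s by simp
  then obtain z where z: "r < z" "z < r + s" "w (r + s) - w r = (r + s - r) * deriv w z"
    using MVT2[of r "r + s" w "deriv w"] dw r by force
  have "\<bar>deriv w z\<bar> \<le> \<bar>deriv w r\<bar>"
    using anti r z by (auto simp: monotone_on_def)
  then have "s * - deriv w z \<le> s * \<bar>deriv w r\<bar>"
    using s by (intro mult_left_mono) auto
  then show ?thesis
    using z(3) by simp
qed simp

text \<open>
  A weight is positive and tends to zero. If its derivative vanished at some point, then by
  monotonicity of \<open>\<bar>deriv w\<bar>\<close> it would vanish from there on, so the weight would end up
  constant.
\<close>

lemma weight_deriv_neg: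
  assumes w: "weight w" and R: "0 < R"
    and dw: "\<And>r. R < r \<Longrightarrow> (w has_real_derivative deriv w r) (at r)"
    and anti: "antimono_on {R<..} (\<lambda>r. \<bar>deriv w r\<bar>)"
    and r: "R < r"
  shows "deriv w r < 0"
proof -
  have "\<not> 0 < deriv w r"
  proof
    assume "0 < deriv w r"
    then obtain d where d: "0 < d" "\<And>h. 0 < h \<Longrightarrow> h < d \<Longrightarrow> w r < w (r + h)"
      using DERIV_pos_inc_right[OF dw[OF r]] by blast
    have "w r < w (r + d / 2)"
      using d(1) by (intro d(2)) auto
    then show False
      using weight_antimono[OF w, of r "r + d / 2"] r R d(1) by auto
  qed
  moreover have "deriv w r \<noteq> 0"
  proof
    assume 0: "deriv w r = 0"
    have le: "w r \<le> w x" if "r \<le> x" for x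
      using above_tangent_if_abs_deriv_antimono[OF dw anti r, of "x - r"] 0 that by simp
    have wr: "0 < w r"
      using weight_pos[OF w] r R by auto
    have "((\<lambda>r. r ^ 0 * w r) \<longlongrightarrow> 0) at_top"
      using w unfolding weight_def by blast
    then have "(w \<longlongrightarrow> 0) at_top"
      by simp
    then have "\<forall>\<^sub>F x in at_top. w x < w r"
      using wr by (rule order_tendstoD)
    then have "\<forall>\<^sub>F x in at_top. w x < w r \<and> r \<le> x"
      using eventually_ge_at_top[of r] by (rule eventually_conj)
    then obtain x where "w x < w r" "r \<le> x"
      using eventually_happens'[of "at_top :: real filter"] by fastforce
    then show False
      using le[of x] by linarith
  qed
  ultimately show ?thesis
    by linarith
qed

text \<open>
  The quotient \<open>w r / \<bar>deriv w r\<bar>\<close> is the length on which the tangent to \<open>w\<close> at \<open>r\<close> descends to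
  zero. By convexity \<open>w\<close> lies above its tangent, so it loses at most half of its value on half of
  this length. This makes \<open>w r / (2 * \<bar>deriv w r\<bar>)\<close> the natural radius in the Cauchy estimate.
\<close>

lemma weighted_derivative_estimate:
  assumes w: "weight w" and R: "0 < R"
    and dw: "\<And>r. R < r \<Longrightarrow> (w has_real_derivative deriv w r) (at r)"
    and anti: "antimono_on {R<..} (\<lambda>r. \<bar>deriv w r\<bar>)"
    and F: "F holomorphic_on UNIV" and K: "\<And>z. w (cmod z) * cmod (F z) \<le> K"
    and z: "R < cmod z"
  shows "(w (cmod z))\<^sup>2 * cmod (deriv F z) \<le> 4 * K * \<bar>deriv w (cmod z)\<bar>"
proof -
  define r where "r = cmod z"
  define s where "s = w r / (2 * \<bar>deriv w r\<bar>)"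
  have r: "R < r"
    using z by (simp add: r_def)
  have d: "0 < \<bar>deriv w r\<bar>"
    using weight_deriv_neg[OF w R dw anti r] by simp
  have wr: "0 < w r"
    using weight_pos[OF w] by (simp add: r_def)
  have s: "0 < s"
    using d wr by (simp add: s_def)
  have half: "w r / 2 \<le> w (r + s)"
    using above_tangent_if_abs_deriv_antimono[OF dw anti r, of s] s d by (simp add: s_def field_simps)
  have "cmod ((deriv ^^ 1) F z) \<le> fact 1 * (2 * K / w r) / s ^ 1"
  proof (rule Cauchy_inequality[OF _ _ s])
    show "F holomorphic_on ball z s"
      using F by (rule holomorphic_on_subset) auto
    show "continuous_on (cball z s) F"
      using F by (intro holomorphic_on_imp_continuous_on) (auto intro: holomorphic_on_subset)
    fix x assume x: "cmod (z - x) = s"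
    have "cmod x \<le> r + s"
      using x norm_triangle_ineq4[of z "z - x"] by (simp add: r_def)
    then have "w r / 2 \<le> w (cmod x)"
      using half weight_antimono[OF w, of "cmod x" "r + s"] by simp
    then have "w r / 2 * cmod (F x) \<le> w (cmod x) * cmod (F x)"
      by (intro mult_right_mono) auto
    also have "\<dots> \<le> K"
      by (rule K)
    finally show "cmod (F x) \<le> 2 * K / w r"
      using wr by (simp add: field_simps)
  qed
  then have "cmod (deriv F z) \<le> 2 * K / w r / s"
    by simp
  also have "\<dots> = 4 * K * \<bar>deriv w r\<bar> / (w r)\<^sup>2"
    using wr d by (simp add: s_def field_simps power2_eq_square)
  finally show ?thesis
    using wr by (simp add: r_def field_simps)
qed

text \<open>
  The function \<open>- deriv w t / (w t)\<^sup>2\<close> is the derivative of \<open>1 / w t\<close>. A derivative bound by a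
  multiple of it along rays therefore integrates to growth of order \<open>1 / w\<close>, with the same
  factor \<open>M\<close>. Keeping track of this factor yields the little-oh version as well.
\<close>

lemma weighted_growth_from_derivative:
  assumes w: "weight w" and R: "0 < R"
    and dw: "\<And>r. R \<le> r \<Longrightarrow> (w has_real_derivative deriv w r) (at r)"
    and neg: "\<And>r. R \<le> r \<Longrightarrow> deriv w r < 0"
    and dF: "\<And>z. (F has_field_derivative F' z) (at z)"
    and bound: "\<And>z. R \<le> cmod z \<Longrightarrow> (w (cmod z))\<^sup>2 * cmod (F' z) \<le> M * \<bar>deriv w (cmod z)\<bar>"
    and A: "\<And>z. cmod z \<le> R \<Longrightarrow> cmod (F z) \<le> A" and M: "0 \<le> M"
  shows "w (cmod z) * cmod (F z) \<le> w (cmod z) * A + M"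
proof (cases "cmod z \<le> R")
  case True
  then have "w (cmod z) * cmod (F z) \<le> w (cmod z) * A"
    using A weight_pos[OF w, of "cmod z"] by (intro mult_left_mono) auto
  then show ?thesis
    using M by simp
next
  case False
  define r where "r = cmod z"
  define u where "u = z / of_real r"
  have r: "R < r" "0 < r"
    using False R by (auto simp: r_def)
  have u: "cmod u = 1" "of_real r * u = z"
    using r by (auto simp: u_def r_def norm_divide)
  have ru: "cmod (of_real t * u) = t" if "R \<le> t" for t
    using that R u by (simp add: norm_mult)
  have wpos: "0 < w t" if "R \<le> t" for t
    using that R weight_pos[OF w] by simp
  have dphi: "((\<lambda>t. M / w t) has_real_derivative M * (- deriv w t / (w t)\<^sup>2)) (at t)"
    if "R \<le> t" for t
    using wpos[OF that] by (auto intro!: derivative_eq_intros dw that simp: power2_eq_square)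
  have df: "((\<lambda>t. F (of_real t * u)) has_vector_derivative F' (of_real t * u) * u) (at t)" for t
  proof -
    have "((\<lambda>x. F (x * u)) has_field_derivative F' (of_real t * u) * u) (at (of_real t))"
      by (rule DERIV_chain2[OF dF]) (auto intro!: derivative_eq_intros)
    then show ?thesis
      by (rule has_vector_derivative_real_field)
  qed
  have "norm (F (of_real r * u) - F (of_real R * u)) \<le> M / w r - M / w R"
  proof (rule differentiable_bound_general[OF r(1)])
    show "continuous_on {R..r} (\<lambda>t. F (of_real t * u))"
      using df by (intro continuous_at_imp_continuous_on ballI)
        (rule has_vector_derivative_continuous)
    show "continuous_on {R..r} (\<lambda>t. M / w t)"
      by (intro continuous_at_imp_continuous_on ballI, rule DERIV_isCont, rule dphi) simp
    fix t assume t: "R < t" "t < r"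
    show "((\<lambda>t. F (of_real t * u)) has_vector_derivative F' (of_real t * u) * u) (at t)"
      by (rule df)
    show "((\<lambda>t. M / w t) has_vector_derivative M * (- deriv w t / (w t)\<^sup>2)) (at t)"
      using dphi[of t] t by (simp add: has_real_derivative_iff_has_vector_derivative)
    have "(w t)\<^sup>2 * cmod (F' (of_real t * u)) \<le> M * - deriv w t"
      using bound[of "of_real t * u"] ru[of t] t neg[of t] by simp
    then show "norm (F' (of_real t * u) * u) \<le> M * (- deriv w t / (w t)\<^sup>2)"
      using wpos[of t] t u by (simp add: norm_mult field_simps)
  qed
  moreover have "cmod (F (of_real R * u)) \<le> A"
    using ru[of R] by (intro A) simp
  moreover have "0 \<le> M / w R"
    using M wpos[of R] by simp
  moreover have "cmod (F z) \<le> cmod (F z - F (of_real R * u)) + cmod (F (of_real R * u))"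
    using norm_triangle_ineq[of "F z - F (of_real R * u)" "F (of_real R * u)"] by simp
  ultimately have "cmod (F z) \<le> A + M / w r"
    using u by simp
  then have "w r * cmod (F z) \<le> w r * (A + M / w r)"
    using wpos[of r] r by (intro mult_left_mono) auto
  then show ?thesis
    using wpos[of r] r by (simp add: r_def algebra_simps)
qed

section \<open>The characterization\<close>

text \<open>
  Testing on a nearly extremal function at \<open>z\<close>, whose image has derivative
  \<open>f z * deriv g z\<close> there, turns the estimate of the operator into one of \<open>deriv g\<close> at \<open>z\<close>. Since
  the test functions lie in \<open>Hzero v\<close>, the hypothesis covers both spaces.
\<close>

lemma symbol_condition_if_bounded:
  assumes v: "weight v" and w: "weight w" and R: "0 < R"
    and dw: "\<And>r. R < r \<Longrightarrow> (w has_real_derivative deriv w r) (at r)"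
    and anti: "antimono_on {R<..} (\<lambda>r. \<bar>deriv w r\<bar>)"
    and g: "g holomorphic_on UNIV"
    and K: "\<And>f z. f \<in> Hzero v \<Longrightarrow> wnorm v f \<le> 1 \<Longrightarrow> w (cmod z) * cmod (Volterra g f z) \<le> K"
    and z: "R < cmod z"
  shows "(w (cmod z))\<^sup>2 * cmod (deriv g z) / (\<bar>deriv w (cmod z)\<bar> * assoc_weight v z) \<le> 8 * K"
proof -
  obtain f where f: "f \<in> Hzero v" "wnorm v f \<le> 1" "1 / 2 < assoc_weight v z * cmod (f z)"
    by (rule almost_extremal_in_Hzero[OF v])
  have hol: "f holomorphic_on UNIV"
    using f by (simp add: Hzero_def)
  have d: "0 < \<bar>deriv w (cmod z)\<bar>"
    using weight_deriv_neg[OF w R dw anti z] by simp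
  have a: "0 < assoc_weight v z"
    by (rule assoc_weight_pos[OF v])
  have "(w (cmod z))\<^sup>2 * cmod (deriv (Volterra g f) z) \<le> 4 * K * \<bar>deriv w (cmod z)\<bar>"
    by (rule weighted_derivative_estimate[OF w R dw anti Volterra_holomorphic[OF hol g] K[OF f(1,2)] z])
  moreover have "deriv (Volterra g f) z = f z * deriv g z"
    by (rule DERIV_imp_deriv[OF Volterra_primitive(1)[OF hol g]])
  ultimately have est: "(w (cmod z))\<^sup>2 * cmod (deriv g z) * cmod (f z) \<le> 4 * K * \<bar>deriv w (cmod z)\<bar>"
    by (simp add: norm_mult mult_ac)
  let ?q = "(w (cmod z))\<^sup>2 * cmod (deriv g z)"
  have "?q * (1 / 2) \<le> ?q * (assoc_weight v z * cmod (f z))"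
    using f(3) by (intro mult_left_mono) auto
  also have "\<dots> = assoc_weight v z * (?q * cmod (f z))"
    by (simp add: mult_ac)
  also have "\<dots> \<le> assoc_weight v z * (4 * K * \<bar>deriv w (cmod z)\<bar>)"
    using est a by (intro mult_left_mono) auto
  finally have "?q \<le> 8 * K * (\<bar>deriv w (cmod z)\<bar> * assoc_weight v z)"
    by (simp add: mult_ac)
  then show ?thesis
    using d a by (simp add: divide_le_eq)
qed

text \<open>
  The symbol condition says nothing about small \<open>z\<close>, but there the size of \<open>Volterra g f\<close> is controlled by
  the maximum of \<open>f\<close> and \<open>deriv g\<close> on a fixed disc.
\<close>

lemma Volterra_disc_bound:
  assumes v: "weight v" and g: "g holomorphic_on UNIV" and S: "0 < S"
  obtains A where "0 \<le> A"
    "\<And>f z. f \<in> Hinf v \<Longrightarrow> cmod z \<le> S \<Longrightarrow> cmod (Volterra g f z) \<le> A * wnorm v f"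
proof -
  have dg: "deriv g holomorphic_on UNIV"
    using g by (rule holomorphic_deriv) simp
  obtain D where D: "\<And>z. cmod z \<le> S \<Longrightarrow> cmod (deriv g z) \<le> D"
    using entire_bounded_on_disc[OF dg, of S] by blast
  have D0: "0 \<le> D"
    using order_trans[OF norm_ge_zero D] S by (metis less_imp_le norm_zero)
  have vS: "0 < v S"
    using weight_pos[OF v] S by simp
  show ?thesis
  proof (rule that)
    show "0 \<le> D / v S * S"
      using D0 vS S by simp
    fix f z assume f: "f \<in> Hinf v" and z: "cmod z \<le> S"
    have hol: "f holomorphic_on UNIV"
      using f by (simp add: Hinf_def)
    have df: "cmod (f x * deriv g x) \<le> wnorm v f / v S * D" if x: "cmod x \<le> S" for x
    proof -
      have "v S * cmod (f x) \<le> v (cmod x) * cmod (f x)"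
        by (rule mult_right_mono[OF weight_antimono[OF v norm_ge_zero x] norm_ge_zero])
      also have "\<dots> \<le> wnorm v f"
        by (rule le_wnorm[OF f])
      finally have "cmod (f x) \<le> wnorm v f / v S"
        using vS by (simp add: field_simps)
      then show ?thesis
        unfolding norm_mult using D[OF x] wnorm_nonneg[OF v f] vS by (intro mult_mono) auto
    qed
    have "norm (Volterra g f z - Volterra g f 0) \<le> wnorm v f / v S * D * norm (z - 0)"
    proof (rule field_differentiable_bound[of "cball 0 S"])
      show "(Volterra g f has_field_derivative f x * deriv g x) (at x within cball 0 S)" for x
        by (rule has_field_derivative_at_within[OF Volterra_primitive(1)[OF hol g]])
      show "cmod (f x * deriv g x) \<le> wnorm v f / v S * D" if "x \<in> cball 0 S" for x
        using that by (intro df) simp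
    qed (use z S in auto)
    also have "\<dots> \<le> wnorm v f / v S * D * S"
      using z vS D0 wnorm_nonneg[OF v f] by (intro mult_left_mono) auto
    finally show "cmod (Volterra g f z) \<le> D / v S * S * wnorm v f"
      using Volterra_primitive(2)[OF hol g] by (simp add: mult_ac)
  qed
qed

text \<open>
  The symbol condition and the definition of the associated
  weight bound the derivative of \<open>Volterra g f\<close> by a multiple of the derivative of \<open>1 / w\<close>.
\<close>

lemma bounded_if_symbol_condition:
  assumes v: "weight v" and w: "weight w" and R: "0 < R"
    and dw: "\<And>r. R < r \<Longrightarrow> (w has_real_derivative deriv w r) (at r)"
    and neg: "\<And>r. R < r \<Longrightarrow> deriv w r < 0"
    and g: "g holomorphic_on UNIV" and M: "0 \<le> M"
    and symb: "\<And>z. R < cmod z \<Longrightarrow>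
      (w (cmod z))\<^sup>2 * cmod (deriv g z) \<le> M * (\<bar>deriv w (cmod z)\<bar> * assoc_weight v z)"
  obtains K where
    "\<And>f z. f \<in> Hinf v \<Longrightarrow> w (cmod z) * cmod (Volterra g f z) \<le> K * wnorm v f"
proof -
  \<comment> \<open>The differentiability of \<open>w\<close> is known only beyond \<open>R\<close>, so the rays are started at \<open>R + 1\<close>.\<close>
  obtain A where A: "0 \<le> A"
    "\<And>f z. f \<in> Hinf v \<Longrightarrow> cmod z \<le> R + 1 \<Longrightarrow> cmod (Volterra g f z) \<le> A * wnorm v f"
    using Volterra_disc_bound[OF v g, of "R + 1"] R by (metis add_pos_pos zero_less_one)
  show ?thesis
  proof (rule that)
    fix f z assume f: "f \<in> Hinf v"
    have hol: "f holomorphic_on UNIV"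
      using f by (simp add: Hinf_def)
    have N: "0 \<le> wnorm v f"
      by (rule wnorm_nonneg[OF v f])
    have "w (cmod z) * cmod (Volterra g f z) \<le> w (cmod z) * (A * wnorm v f) + M * wnorm v f"
    proof (rule weighted_growth_from_derivative[OF w, where R = "R + 1" and F' = "\<lambda>z. f z * deriv g z"])
      fix x :: complex assume x: "R + 1 \<le> cmod x"
      have "(w (cmod x))\<^sup>2 * cmod (f x * deriv g x) = (w (cmod x))\<^sup>2 * cmod (deriv g x) * cmod (f x)"
        by (simp add: norm_mult mult_ac)
      also have "\<dots> \<le> M * (\<bar>deriv w (cmod x)\<bar> * assoc_weight v x) * cmod (f x)"
        using symb[of x] x by (intro mult_right_mono) auto
      also have "\<dots> = M * \<bar>deriv w (cmod x)\<bar> * (assoc_weight v x * cmod (f x))"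
        by (simp add: mult_ac)
      also have "\<dots> \<le> M * \<bar>deriv w (cmod x)\<bar> * wnorm v f"
        using M by (intro mult_left_mono assoc_weight_bound[OF v hol] le_wnorm[OF f]) auto
      finally show "(w (cmod x))\<^sup>2 * cmod (f x * deriv g x) \<le> M * wnorm v f * \<bar>deriv w (cmod x)\<bar>"
        by (simp add: mult_ac)
    qed (use R dw neg M N A(2)[OF f] Volterra_primitive(1)[OF hol g] in auto)
    also have "\<dots> \<le> w 0 * (A * wnorm v f) + M * wnorm v f"
      using A(1) N weight_antimono[OF w, of 0 "cmod z"] by (intro add_right_mono mult_right_mono) auto
    finally show "w (cmod z) * cmod (Volterra g f z) \<le> (w 0 * A + M) * wnorm v f"
      by (simp add: algebra_simps)
  qed
qed

text \<open>
  For \<open>f\<close> in \<open>Hzero v\<close> the factor in front of the derivative of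
  \<open>1 / w\<close> is arbitrarily small far out, and the contribution of the remaining disc is a constant,
  which \<open>w\<close> sends to zero.
\<close>

lemma Volterra_in_Hzero_if_symbol_condition:
  assumes v: "weight v" and w: "weight w" and R: "0 < R"
    and dw: "\<And>r. R < r \<Longrightarrow> (w has_real_derivative deriv w r) (at r)"
    and neg: "\<And>r. R < r \<Longrightarrow> deriv w r < 0"
    and g: "g holomorphic_on UNIV" and M: "0 \<le> M"
    and symb: "\<And>z. R < cmod z \<Longrightarrow>
      (w (cmod z))\<^sup>2 * cmod (deriv g z) \<le> M * (\<bar>deriv w (cmod z)\<bar> * assoc_weight v z)"
    and f: "f \<in> Hzero v"
  shows "Volterra g f \<in> Hzero w"
proof -
  have hol: "f holomorphic_on UNIV" and inf: "f \<in> Hinf v"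
    using f Hzero_subset_Hinf[OF v] by (auto simp: Hzero_def)
  have "((\<lambda>z. w (cmod z) * cmod (Volterra g f z)) \<longlongrightarrow> 0) at_infinity"
    unfolding Lim_at_infinity
  proof (intro allI impI)
    fix e :: real assume e: "0 < e"
    \<comment> \<open>The denominator uses \<open>M + 1\<close> because \<open>M\<close> may be zero.\<close>
    define c where "c = e / (2 * (M + 1))"
    have c: "0 < c" "M * c \<le> e / 2"
      using M e by (auto simp: c_def field_simps)
    obtain b where b: "\<And>z. b \<le> cmod z \<Longrightarrow> dist (assoc_weight v z * cmod (f z)) 0 < c"
      using assoc_weight_tendsto_Hzero[OF v f] c(1) unfolding Lim_at_infinity by meson
    define S where "S = max b (R + 1)"
    have S: "b \<le> S" "R < S" "0 < S"
      using R by (auto simp: S_def)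
    obtain A where A:
      "\<And>f z. f \<in> Hinf v \<Longrightarrow> cmod z \<le> S \<Longrightarrow> cmod (Volterra g f z) \<le> A * wnorm v f"
      using Volterra_disc_bound[OF v g S(3)] by metis
    define D where "D = A * wnorm v f"
    have grow: "w (cmod z) * cmod (Volterra g f z) \<le> w (cmod z) * D + e / 2" for z
    proof (rule weighted_growth_from_derivative[OF w S(3), where F' = "\<lambda>z. f z * deriv g z"])
      fix x :: complex assume x: "S \<le> cmod x"
      have "(w (cmod x))\<^sup>2 * cmod (f x * deriv g x) = (w (cmod x))\<^sup>2 * cmod (deriv g x) * cmod (f x)"
        by (simp add: norm_mult mult_ac)
      also have "\<dots> \<le> M * (\<bar>deriv w (cmod x)\<bar> * assoc_weight v x) * cmod (f x)"
        using symb[of x] x S by (intro mult_right_mono) auto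
      also have "\<dots> = M * \<bar>deriv w (cmod x)\<bar> * (assoc_weight v x * cmod (f x))"
        by (simp add: mult_ac)
      also have "\<dots> \<le> M * \<bar>deriv w (cmod x)\<bar> * c"
        using M b[of x] x S by (intro mult_left_mono) auto
      also have "\<dots> = M * c * \<bar>deriv w (cmod x)\<bar>"
        by (simp add: mult_ac)
      also have "\<dots> \<le> e / 2 * \<bar>deriv w (cmod x)\<bar>"
        using c by (intro mult_right_mono) auto
      finally show "(w (cmod x))\<^sup>2 * cmod (f x * deriv g x) \<le> e / 2 * \<bar>deriv w (cmod x)\<bar>" .
    qed (use S dw neg e A[OF inf] Volterra_primitive(1)[OF hol g] in \<open>auto simp: D_def\<close>)
    have "((\<lambda>z::complex. w (cmod z) * cmod z ^ 0 * D) \<longlongrightarrow> 0 * D) at_infinity"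
      by (intro tendsto_mult tendsto_const weight_tendsto_monomial[OF w])
    then have "((\<lambda>z::complex. w (cmod z) * D) \<longlongrightarrow> 0) at_infinity"
      by simp
    then obtain b' where b': "\<And>z::complex. b' \<le> cmod z \<Longrightarrow> dist (w (cmod z) * D) 0 < e / 2"
      using e unfolding Lim_at_infinity by (meson half_gt_zero)
    have "dist (w (cmod z) * cmod (Volterra g f z)) 0 < e" if z: "b' \<le> cmod z" for z
    proof -
      have "w (cmod z) * cmod (Volterra g f z) < e"
        using grow[of z] b'[OF z] by (simp add: abs_less_iff)
      then show ?thesis
        using weight_pos[OF w, of "cmod z"] by simp
    qed
    then show "\<exists>b. \<forall>z. b \<le> cmod z \<longrightarrow> dist (w (cmod z) * cmod (Volterra g f z)) 0 < e"
      by blast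
  qed
  then show ?thesis
    using Volterra_holomorphic[OF hol g] by (simp add: Hzero_def)
qed

theorem theorem3p6:
  fixes v w :: "real \<Rightarrow> real" and R C \<delta> :: real and g :: "complex \<Rightarrow> complex"
  assumes "weight v" and "weight w"
    and "R > 0" and "C > 0" and "0 < \<delta>" and "\<delta> \<le> 1"
    and "C2_on {R<..} w"
    and "antimono_on {R<..} (\<lambda>r. \<bar>deriv w r\<bar> * r powr (1 + \<delta>))"
    and "\<And>r. r > R \<Longrightarrow> - (w r * deriv (deriv w) r / (deriv w r)\<^sup>2) \<le> C"
    and "g holomorphic_on UNIV"
  shows "(continuous_operator v (Hinf v) w (Hinf w) (Volterra g) \<longleftrightarrow>
          continuous_operator v (Hzero v) w (Hzero w) (Volterra g)) \<and>
         (continuous_operator v (Hzero v) w (Hzero w) (Volterra g) \<longleftrightarrow>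
          bdd_above ((\<lambda>z. (w (cmod z))\<^sup>2 * cmod (deriv g z) /
                          (\<bar>deriv w (cmod z)\<bar> * assoc_weight v z)) ` {z. cmod z > R}))"
proof -
  note v = assms(1) and w = assms(2) and R = assms(3) and g = assms(10)
  have dw: "(w has_real_derivative deriv w r) (at r)" if "R < r" for r
    using assms(7) that unfolding C2_on_def
    by (auto simp: DERIV_deriv_iff_real_differentiable)
  \<comment> \<open>The factor \<open>r powr (1 + \<delta>)\<close> increases, so \<open>\<bar>deriv w\<bar>\<close> itself must be non-increasing. Since
    \<open>deriv w\<close> is negative, this is convexity of \<open>w\<close>.\<close>
  have anti: "antimono_on {R<..} (\<lambda>r. \<bar>deriv w r\<bar>)"
  proof (rule monotone_onI)
    fix r s :: real assume rs: "r \<in> {R<..}" "s \<in> {R<..}" "r \<le> s"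
    have "\<bar>deriv w s\<bar> * s powr (1 + \<delta>) \<le> \<bar>deriv w r\<bar> * r powr (1 + \<delta>)"
      using assms(8) rs by (auto simp: monotone_on_def)
    also have "\<dots> \<le> \<bar>deriv w r\<bar> * s powr (1 + \<delta>)"
      using rs R assms(5) by (intro mult_left_mono powr_mono2) auto
    finally show "\<bar>deriv w s\<bar> \<le> \<bar>deriv w r\<bar>"
      using rs R by simp
  qed
  have neg: "deriv w r < 0" if "R < r" for r
    by (rule weight_deriv_neg[OF w R dw anti that])
  let ?Q = "\<lambda>z. (w (cmod z))\<^sup>2 * cmod (deriv g z) / (\<bar>deriv w (cmod z)\<bar> * assoc_weight v z)"
  let ?inf = "continuous_operator v (Hinf v) w (Hinf w) (Volterra g)"
  let ?zero = "continuous_operator v (Hzero v) w (Hzero w) (Volterra g)"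
  let ?bdd = "bdd_above (?Q ` {z. cmod z > R})"
  have bdd: ?bdd
    if X: "Hzero v \<subseteq> X" "X \<subseteq> Hinf v" and Y: "Y \<subseteq> Hinf w"
      and scale: "\<And>f c. f \<in> X \<Longrightarrow> 0 \<le> c \<Longrightarrow> (\<lambda>z. complex_of_real c * f z) \<in> X"
      and cont: "continuous_operator v X w Y (Volterra g)" for X Y
  proof -
    have "(\<lambda>z. 0) \<in> X"
      using X(1) by (auto simp: Hzero_def)
    then obtain K where K:
      "\<And>f z. f \<in> X \<Longrightarrow> wnorm v f \<le> 1 \<Longrightarrow> w (cmod z) * cmod (Volterra g f z) \<le> K"
      using bounded_if_continuous_Volterra[OF v g X(2) Y _ scale cont] by metis
    have "?Q z \<le> 8 * K" if "R < cmod z" for z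
      using symbol_condition_if_bounded[OF v w R dw anti g _ that] K X(1) by blast
    then show ?thesis
      by (intro bdd_aboveI2) auto
  qed
  have sufficient: "?inf \<and> ?zero" if b: ?bdd
  proof -
    obtain M0 where M0: "\<And>z. R < cmod z \<Longrightarrow> ?Q z \<le> M0"
      using b unfolding bdd_above_def by auto
    define M where "M = max M0 0"
    have M: "0 \<le> M"
      by (simp add: M_def)
    have symb: "(w (cmod z))\<^sup>2 * cmod (deriv g z) \<le> M * (\<bar>deriv w (cmod z)\<bar> * assoc_weight v z)"
      if z: "R < cmod z" for z
    proof -
      have "0 < \<bar>deriv w (cmod z)\<bar> * assoc_weight v z"
        using neg[OF z] assoc_weight_pos[OF v, of z] by (intro mult_pos_pos) auto
      moreover have "?Q z \<le> M"
        using M0[OF z] by (simp add: M_def)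
      ultimately show ?thesis
        by (simp add: divide_le_eq)
    qed
    obtain K where K:
      "\<And>f z. f \<in> Hinf v \<Longrightarrow> w (cmod z) * cmod (Volterra g f z) \<le> K * wnorm v f"
      using bounded_if_symbol_condition[OF v w R dw neg g M symb] by metis
    have norm: "wnorm w (Volterra g f) \<le> K * wnorm v f" if "f \<in> Hinf v" for f
      using K[OF that] by (rule wnorm_le)
    have maps: "Volterra g f \<in> Hinf w" if "f \<in> Hinf v" for f
      using that by (intro HinfI[OF Volterra_holomorphic[OF _ g] K]) (auto simp: Hinf_def)
    have ?inf
      using continuous_Volterra_if_bounded[OF v g order_refl Hinf_diff[OF v] maps norm] .
    moreover have ?zero
    proof (rule continuous_Volterra_if_bounded[OF v g Hzero_subset_Hinf[OF v] Hzero_diff[OF v]])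
      show "Volterra g f \<in> Hzero w" if "f \<in> Hzero v" for f
        by (rule Volterra_in_Hzero_if_symbol_condition[OF v w R dw neg g M symb that])
      show "wnorm w (Volterra g f) \<le> K * wnorm v f" if "f \<in> Hzero v" for f
        using that Hzero_subset_Hinf[OF v] by (intro norm) auto
    qed
    ultimately show ?thesis ..
  qed
  have "?bdd" if ?inf
    using Hzero_subset_Hinf[OF v] Hinf_scale(1) that by (intro bdd[of "Hinf v" "Hinf w"]) auto
  moreover have "?bdd" if ?zero
    using Hzero_subset_Hinf[OF v] Hzero_subset_Hinf[OF w] Hzero_scale that
    by (intro bdd[of "Hzero v" "Hzero w"]) auto
  ultimately show ?thesis
    using sufficient by (intro conjI iffI) simp_all
qed

end
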